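(* Let $(F_n)_{n\ge 0}$ and $(L_n)_{n\ge 0}$ be the Fibonacci and Lucas sequences. The Fibonacci numbers which are concatenations of a Lucas number and a Fibonacci number (in this order) are exactly $13$ and $21$. That is, the set of all integers $F_n$ with $n \ge 0$ for which there exist integers $m, k \ge 0$ such that $$F_n = 10^d L_m + F_k,$$ where $d$ is the number of decimal digits of $F_k$, is equal to $\{13, 21\}$.
   Context: The Fibonacci sequence is defined by $F_0=0$, $F_1=1$, $F_{n+2}=F_{n+1}+F_n$ for $n\ge 0$. The Lucas sequence is defined by $L_0=2$, $L_1=1$, $L_{n+2}=L_{n+1}+L_n$ for $n\ge 0$. For non-negative integers $a,b$, the concatenation $\overline{ab}$ is the integer $10^d a + b$, where $d$ is the number of decimal digits of $b$: $d=\lfloor \log_{10} b\rfloor+1$ for $b\ge 1$, and $d=1$ for $b=0$. *)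

theory Defs
  imports Complex_Main "HOL-Number_Theory.Fib"
begin

fun lucas :: "nat \<Rightarrow> nat" where
  "lucas 0 = 2"
| "lucas (Suc 0) = 1"
| "lucas (Suc (Suc n)) = lucas (Suc n) + lucas n"

(* The number 0 is written with one digit. *)
definition num_digits :: "nat \<Rightarrow> nat" where
  "num_digits b = (if b = 0 then 1 else nat \<lfloor>log 10 (real b)\<rfloor> + 1)"

definition concatenation :: "nat \<Rightarrow> nat \<Rightarrow> nat" where
  "concatenation a b = 10 ^ num_digits b * a + b"

end

theory Submission
  imports Defs
begin

text \<open>
  Write \<open>F\<^sub>n = 10\<^sup>d L\<^sub>m + F\<^sub>k\<close> with \<open>k > 0\<close>. Comparing sizes gives \<open>n = k + m + c\<close> with \<open>0 \<le> c \<le> 7\<close>. If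
  \<open>m > k + c\<close>, then \<open>F\<^sub>n = L\<^sub>m F\<^sub>j \<plusminus> F\<^bsub>m-j\<^esub>\<close> with \<open>j = n - m\<close> forces \<open>F\<^sub>j = 10\<^sup>d\<close>, which is impossible
  because \<open>10 | F\<^sub>j\<close> implies \<open>610 | F\<^sub>j\<close>; so \<open>m\<close> and \<open>n\<close> are bounded linearly in \<open>k\<close>, hence in \<open>d\<close>.

  If \<open>n - k\<close> is even, then \<open>F\<^sub>n - F\<^sub>k\<close> factors as \<open>F\<^sub>a L\<^sub>b\<close> with \<open>{a, b} = {(n + k)/2, (n - k)/2}\<close>. No Lucas
  number is divisible by 5, and \<open>5\<^sup>d | F\<^sub>a\<close> implies \<open>5\<^sup>d | a\<close>, so \<open>d\<close> is small.

  If \<open>n - k\<close> is odd, reduce modulo \<open>L\<^sub>m\<close>: every Fibonacci number \<open>F\<^sub>n\<close> is congruent to some \<open>\<plusminus>F\<^sub>r\<close>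
  with \<open>r \<le> m\<close> and \<open>n \<equiv> \<plusminus>r (mod 2m)\<close>. As \<open>2F\<^sub>m < L\<^sub>m\<close>, the residues \<open>r\<close>, \<open>s\<close> belonging to \<open>n\<close> and \<open>k\<close>
  satisfy \<open>F\<^sub>r = F\<^sub>s\<close> and differ in parity, so \<open>{r, s} = {1, 2}\<close> and \<open>2m\<close> divides \<open>m + c + t\<close> for some
  \<open>|t| \<le> 3\<close>. Thus \<open>m \<le> c + 3\<close>, and the finitely many pairs \<open>(m, c)\<close> are excluded for \<open>d \<ge> 4\<close> by
  the residues of \<open>F\<^bsub>k+m+c\<^esub> - F\<^sub>k\<close> modulo 16, 5 and 11.
\<close>

section \<open>Identities for Fibonacci and Lucas numbers\<close>

text \<open>Writing F_(m-1) as F_(m+1) - F_m avoids a predecessor index. With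
  \<open>lucas_int\<close> and \<open>cassini_int\<close>, later identities become polynomial
  identities in consecutive Fibonacci numbers.\<close>

lemma fib_add_int:
  "int (fib (m + n)) = int (fib m) * int (fib (Suc n)) + int (fib (Suc m)) * int (fib n)
     - int (fib m) * int (fib n)"
proof (cases m)
  case (Suc l)
  then show ?thesis
    using fib_add[of n l] by (simp add: algebra_simps)
qed auto

lemma lucas_int: "int (lucas n) = 2 * int (fib (Suc n)) - int (fib n)"
  by (induction n rule: lucas.induct) simp_all

lemma cassini_int: "(-1) ^ n = int (fib (Suc n))^2 - int (fib n) * int (fib (Suc n)) - int (fib n)^2"
  using fib_Cassini_int[of n] by (simp add: algebra_simps power2_eq_square)

lemma fib_add_Suc_int:
  "int (fib (Suc (m + n))) = int (fib (Suc m)) * int (fib (Suc n)) + int (fib m) * int (fib n)"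
  using fib_add[of m n] by (simp add: mult.commute)

lemma fib_add_double:
  "int (fib (k + 2 * m)) = int (lucas m) * int (fib (k + m)) - (-1) ^ m * int (fib k)"
proof -
  have "k + 2 * m = k + (m + m)" by simp
  then show ?thesis
    by (simp only: fib_add_int fib_add_Suc_int lucas_int cassini_int) 
       (simp add: algebra_simps power2_eq_square)
qed

lemma fib_double_add:
  "int (fib (2 * j + k)) = int (lucas (j + k)) * int (fib j) + (-1) ^ j * int (fib k)"
proof -
  have "2 * j + k = j + (j + k)" by simp
  then show ?thesis
    by (simp only: fib_add_int fib_add_Suc_int lucas_int cassini_int) 
       (simp add: algebra_simps power2_eq_square)
qed

lemma lucas_pos: "0 < lucas n"
  by (induction n rule: lucas.induct) simp_all

lemma fib_less_imp_less: "fib m < fib n \<Longrightarrow> m < n"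
  using fib_mono[of n m] by linarith

section \<open>Divisibility by powers of 5 and 10\<close>

text \<open>Passing from n to 5n adds exactly one factor 5, since 5q + 1 is prime to 5.\<close>

lemma fib_quintuple:
  "\<exists>q. int (fib (5 * n)) = 5 * int (fib n) * (5 * q + 1)"
proof -
  define x y where "x = int (fib n)" and "y = int (fib (Suc n))"
  \<comment> \<open>By Cassini's identity this quadratic form equals (-1)^n.\<close>
  define e where "e = y^2 - x*y - x^2"
  have e: "e = 1 \<or> e = -1"
    unfolding e_def x_def y_def cassini_int[symmetric] by (simp add: neg_one_even_power minus_one_power_iff)
  have "5 * n = n + ((n + n) + (n + n))" by simp
  then have "int (fib (5 * n)) = x * (25 * x^4 + 25 * e * x^2 + 5 * e^2)"
    unfolding e_def by (simp only: fib_add_int fib_add_Suc_int x_def[symmetric] y_def[symmetric])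
       (simp add: algebra_simps power2_eq_square power4_eq_xxxx)
  moreover have "e^2 = 1" using e by auto
  ultimately have "int (fib (5 * n)) = 5 * x * (5 * (x^4 + e * x^2) + 1)"
    by (simp add: algebra_simps)
  then show ?thesis unfolding x_def by blast
qed

lemma dvd_5_cases:
  fixes g :: nat
  assumes "g dvd 5"
  shows "g = 1 \<or> g = 5"
proof -
  have "g \<le> 5" using assms by (rule dvd_imp_le) simp
  then have "g = 0 \<or> g = 1 \<or> g = 2 \<or> g = 3 \<or> g = 4 \<or> g = 5" by linarith
  then show ?thesis using assms by auto
qed

lemma dvd_15_cases:
  fixes g :: nat
  assumes "g dvd 15"
  shows "g \<in> {1, 3, 5, 15}"
proof -
  have "g \<le> 15" using assms by (rule dvd_imp_le) simp
  then have "g \<in> {..15}" by simp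
  then show ?thesis using assms by (auto simp: atMost_nat_numeral)
qed

lemma five_dvd_fib_iff: "5 dvd fib n \<longleftrightarrow> 5 dvd n"
proof -
  have fib5: "fib 5 = 5" by (simp add: eval_nat_numeral)
  have "gcd 5 (fib n) = fib (gcd 5 n)"
    using fib_gcd[of 5 n] by (simp add: fib5)
  moreover have "gcd 5 n = 1 \<or> gcd 5 n = 5"
    by (rule dvd_5_cases) simp
  ultimately show ?thesis
    unfolding gcd_nat.absorb_iff1[of 5] by (auto simp: fib5)
qed

lemma pow5_dvd_fib: "5 ^ d dvd fib n \<Longrightarrow> 5 ^ d dvd n"
proof (induction d arbitrary: n)
  case (Suc d)
  have "5 dvd (5::nat) ^ Suc d" by simp
  then have "5 dvd fib n" using Suc.prems dvd_trans by blast
  then obtain l where l: "n = 5 * l" using five_dvd_fib_iff by auto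
  obtain q where q: "int (fib n) = 5 * int (fib l) * (5 * q + 1)"
    using fib_quintuple[of l] l by auto
  have "int (5 ^ Suc d) dvd int (fib n)" using Suc.prems by (simp only: int_dvd_int_iff)
  then have "5 ^ d dvd int (fib l) * (5 * q + 1)" by (simp add: q)
  moreover have "coprime (5 ^ d) (5 * q + 1)"
  proof -
    have "coprime 5 (5 * q + 1)" 
      by (metis coprime_1_right coprime_iff_gcd_eq_1 gcd_add_mult mult.commute gcd.commute)
    then show ?thesis by simp
  qed
  ultimately have "5 ^ d dvd int (fib l)"
    by (simp add: coprime_dvd_mult_left_iff)
  then have "5 ^ d dvd fib l" by (metis int_dvd_int_iff of_nat_numeral of_nat_power)
  then show ?case using Suc.IH l by simp
qed simp

lemma not_five_dvd_lucas: "\<not> 5 dvd lucas n"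
proof
  assume "5 dvd lucas n"
  then have "5 dvd int (lucas n)" by presburger
  \<comment> \<open>Uses L_n^2 - 5 F_n^2 = 4 (-1)^n, which is prime to 5.\<close>
  then have "5 dvd int (lucas n) ^ 2 - 5 * int (fib n) ^ 2"
    by (simp add: power2_eq_square)
  also have "int (lucas n) ^ 2 - 5 * int (fib n) ^ 2 = 4 * (-1) ^ n"
    unfolding lucas_int cassini_int by (simp add: algebra_simps power2_eq_square)
  finally show False by (simp add: minus_one_power_iff split: if_splits)
qed

lemma fib_not_pow10:
  assumes "0 < d"
  shows "fib n \<noteq> 10 ^ d"
proof
  assume eq: "fib n = 10 ^ d"
  have fib3: "fib 3 = 2" and fib5: "fib 5 = 5" and "fib 7 = 13" and "fib 8 = 21"
    by (simp_all add: eval_nat_numeral)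
  then have fib15: "fib 15 = 610"
    using fib_rec_odd[of 7] by simp
  have "10 dvd fib n" using assms eq by simp
  \<comment> \<open>As F_15 = 610, 10 divides gcd(F_15, F_n); this leaves only 15 as gcd of the
    indices and brings in the prime 61.\<close>
  then have "10 dvd fib (gcd 15 n)" unfolding fib_gcd fib15 by simp
  moreover have "gcd 15 n \<in> {1, 3, 5, 15}"
    by (rule dvd_15_cases) simp
  ultimately have "gcd 15 n = 15"
    by (auto simp: fib3 fib5)
  then have "610 dvd fib n" by (metis fib15 fib_gcd gcd_dvd2)
  then have "61 dvd fib n" by (rule dvd_trans[rotated]) simp
  moreover have "coprime (61::nat) 10"
    by (simp add: coprime_iff_gcd_eq_1 gcd_non_0_nat)
  ultimately have "\<not> 61 dvd (10::nat) ^ d"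
    using coprime_absorb_left[of 61 "(10::nat) ^ d"] by auto
  then show False using eq \<open>61 dvd fib n\<close> by simp
qed

section \<open>Size estimates and bounds on the indices\<close>

text \<open>Both sides satisfy the Fibonacci recurrence in m, so comparing them at m = 0 and m = 1
  suffices.\<close>

lemma fib_mult_lucas_lower: "fib (k + m) \<le> fib (Suc k) * lucas m"
proof (induction m rule: lucas.induct)
  case 1
  show ?case using fib_Suc_mono[of k] by simp
qed (simp_all add: algebra_simps)

lemma fib_mult_lucas_upper: "fib k * lucas m \<le> 2 * fib (k + m)"
proof (induction m rule: lucas.induct)
  case 2
  show ?case using fib_Suc_mono[of k] by simp
qed (simp_all add: algebra_simps)

lemma pow10_le_fib: "10 ^ d \<le> fib (5 * d + 2)"
proof (induction d)
  case (Suc d)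
  have "10 * fib (p + 2) \<le> fib (p + 7)" for p
    using fib_Suc_mono[of p] by (simp add: eval_nat_numeral)
  from this[of "5 * d"] Suc show ?case by (simp add: algebra_simps)
qed simp

lemma num_digits_fib:
  assumes "0 < b"
  shows "10 ^ num_digits b \<le> 10 * b" "b < 10 ^ num_digits b"
proof -
  define l where "l = nat \<lfloor>log 10 (real b)\<rfloor>"
  have "0 \<le> log 10 (real b)" using assms by simp
  then have "\<lfloor>log (real 10) (real b)\<rfloor> = int l" unfolding l_def by simp
  then have "10 ^ l \<le> b" "b < 10 ^ (l + 1)"
    using floor_log_nat_eq_powr_iff[of 10 b l] assms by simp_all
  moreover have "num_digits b = Suc l" using assms by (simp add: num_digits_def l_def)
  ultimately show "10 ^ num_digits b \<le> 10 * b" "b < 10 ^ num_digits b" by simp_all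
qed

lemma concatenation_index_bounds:
  assumes eq: "fib n = 10 ^ d * lucas m + fib k"
    and k: "0 < k" and lo: "10 ^ d \<le> 10 * fib k" and hi: "fib k < 10 ^ d"
  obtains c where "n = k + m + c" "c \<le> 7"
proof -
  obtain k' where k': "k = Suc k'" using k gr0_conv_Suc by blast
  have "fib (k' + m) \<le> fib k * lucas m" unfolding k' by (rule fib_mult_lucas_lower)
  also have "\<dots> < 10 ^ d * lucas m" using hi lucas_pos by simp
  also have "\<dots> \<le> fib n" using eq by simp
  finally have lower: "k + m \<le> n" using fib_less_imp_less k' by fastforce
  have "fib k * 1 \<le> fib k * lucas m"
    using lucas_pos[of m] by (intro mult_le_mono) auto
  moreover have "10 ^ d * lucas m \<le> 10 * fib k * lucas m"
    using lo by (rule mult_le_mono1)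
  ultimately have "fib n \<le> 11 * (fib k * lucas m)" unfolding eq by linarith
  also have "\<dots> \<le> 22 * fib (k + m)" using fib_mult_lucas_upper[of k m] by linarith
  also have "\<dots> < 22 * fib (k + m) + fib (k + m)"
    using fib_neq_0_nat[of "k + m"] k by simp
  \<comment> \<open>F_(x+8) = 21 F_(x+1) + 13 F_x is at least 34 F_x, whereas a shift by 7
    guarantees only 21 F_x.\<close>
  also have "\<dots> \<le> fib (k + m + 8)"
    using fib_Suc_mono[of "k + m"] by (simp add: eval_nat_numeral)
  finally have "n < k + m + 8" by (rule fib_less_imp_less)
  with lower show ?thesis by (intro that[of "n - (k + m)"]) auto
qed

text \<open>If m were larger, L_m would divide F_k - (-1)^j F_y with nonzero quotient
  \<open>e\<close>, although F_k + F_y < L_m.\<close>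

lemma lucas_index_bound:
  assumes eq: "fib n = 10 ^ d * lucas m + fib k"
    and k: "0 < k" and d: "0 < d" and n: "n = k + m + c"
  shows "m \<le> k + c"
proof (rule ccontr)
  assume "\<not> m \<le> k + c"
  then obtain y where y: "m = k + c + y" "0 < y"
    by (metis less_imp_add_positive not_le)
  define j where "j = k + c"
  have "n = 2 * j + y" "m = j + y" using n y by (simp_all add: j_def)
  define e where "e = int (fib j) - 10 ^ d"
  have "int (fib n) = int (lucas m) * int (fib j) + (-1) ^ j * int (fib y)"
    using fib_double_add[of j y] \<open>n = 2 * j + y\<close> \<open>m = j + y\<close> by simp
  moreover have "int (fib n) = 10 ^ d * int (lucas m) + int (fib k)"
    by (simp add: eq)
  ultimately have Le: "int (lucas m) * e = int (fib k) - (-1) ^ j * int (fib y)"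
    unfolding e_def by (simp add: algebra_simps)
  have "e \<noteq> 0"
  proof
    assume "e = 0"
    then have "int (fib j) = int (10 ^ d)" by (simp add: e_def)
    then show False using fib_not_pow10[OF d, of j] by (simp only: of_nat_eq_iff)
  qed
  then have "int (lucas m) * 1 \<le> int (lucas m) * \<bar>e\<bar>"
    by (intro mult_left_mono) auto
  also have "\<dots> = \<bar>int (fib k) - (-1) ^ j * int (fib y)\<bar>"
    unfolding Le[symmetric] abs_mult by simp
  also have "\<dots> \<le> int (fib k) + int (fib y)"
    by (cases "even j") auto
  finally have "lucas m \<le> fib k + fib y" by linarith
  moreover have "0 < m" using y by simp
  then obtain m' where m': "m = Suc m'" using gr0_conv_Suc by blast
  have "fib y \<le> fib m'" using y m' k by (intro fib_mono) auto
  moreover have "fib k \<le> fib m" using y by (intro fib_mono) auto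
  moreover have "lucas m = fib m + 2 * fib m'"
    using lucas_int[of m] m' by simp
  moreover have "0 < fib m'" using y m' k by (intro fib_neq_0_nat) auto
  ultimately show False by linarith
qed

section \<open>Even index difference: powers of 5\<close>

lemma coprime_pow5_lucas: "coprime (5 ^ d) (lucas n)"
proof -
  have "gcd 5 (lucas n) = 1 \<or> gcd 5 (lucas n) = 5" by (rule dvd_5_cases) simp
  moreover have "gcd 5 (lucas n) \<noteq> 5" by (metis gcd_dvd2 not_five_dvd_lucas)
  ultimately have "coprime 5 (lucas n)" by (simp add: coprime_iff_gcd_eq_1)
  then show ?thesis by simp
qed

text \<open>The Lucas factor of F_n - F_k is prime to 5, so 5^d divides the Fibonacci factor and
  hence its index: v for even v, k + v for odd v.\<close>

lemma pow5_le_if_even_index_diff: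
  assumes eq: "fib n = 10 ^ d * lucas m + fib k"
    and n: "n = k + 2 * v" and "0 < v"
  shows "5 ^ d \<le> k + v"
proof (cases "even v")
  case True
  have "int (fib n) = int (lucas (v + k)) * int (fib v) + int (fib k)"
    using fib_double_add[of v k] True n by (simp add: algebra_simps)
  then have "int (10 ^ d * lucas m) = int (lucas (v + k) * fib v)"
    using eq by simp
  then have "10 ^ d * lucas m = lucas (v + k) * fib v" by (simp only: of_nat_eq_iff)
  moreover have "(5::nat) ^ d dvd 10 ^ d * lucas m" by (simp add: dvd_power_same)
  ultimately have "5 ^ d dvd lucas (v + k) * fib v" by simp
  moreover have "coprime (5 ^ d) (lucas (v + k))" by (rule coprime_pow5_lucas)
  ultimately have "5 ^ d dvd fib v" by (simp add: coprime_dvd_mult_right_iff)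
  then have "5 ^ d dvd v" by (rule pow5_dvd_fib)
  then have "5 ^ d \<le> v" using \<open>0 < v\<close> by (rule dvd_imp_le)
  then show ?thesis by simp
next
  case False
  have "int (fib n) = int (lucas v) * int (fib (k + v)) + int (fib k)"
    using fib_add_double[of k v] False n by (simp add: algebra_simps)
  then have "int (10 ^ d * lucas m) = int (lucas v * fib (k + v))"
    using eq by simp
  then have "10 ^ d * lucas m = lucas v * fib (k + v)" by (simp only: of_nat_eq_iff)
  moreover have "(5::nat) ^ d dvd 10 ^ d * lucas m" by (simp add: dvd_power_same)
  ultimately have "5 ^ d dvd lucas v * fib (k + v)" by simp
  moreover have "coprime (5 ^ d) (lucas v)" by (rule coprime_pow5_lucas)
  ultimately have "5 ^ d dvd fib (k + v)" by (simp add: coprime_dvd_mult_right_iff)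
  then have "5 ^ d dvd k + v" by (rule pow5_dvd_fib)
  then show ?thesis by (rule dvd_imp_le) (use \<open>0 < v\<close> in simp)
qed

section \<open>Odd index difference: reduction modulo a Lucas number\<close>

lemma dvd_plus_minus_trans:
  fixes a b c l :: int
  assumes "l dvd a - b \<or> l dvd a + b" "l dvd b - c \<or> l dvd b + c"
  shows "l dvd a - c \<or> l dvd a + c"
  using assms
proof (elim disjE)
  assume "l dvd a - b" "l dvd b - c"
  from dvd_add[OF this] show ?thesis by simp
next
  assume "l dvd a - b" "l dvd b + c"
  from dvd_add[OF this] show ?thesis by simp
next
  assume "l dvd a + b" "l dvd b - c"
  from dvd_diff[OF this] show ?thesis by simp
next
  assume "l dvd a + b" "l dvd b + c"
  from dvd_diff[OF this] show ?thesis by simp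
qed

text \<open>Shifting an index by 2m or reflecting it at m changes F_n only by a sign modulo L_m. The
  signs in the two disjunctions are independent.\<close>

lemma fib_mod_lucas:
  assumes "0 < m"
  shows "\<exists>r\<le>m. (int (2 * m) dvd int n - int r \<or> int (2 * m) dvd int n + int r) \<and>
     (int (lucas m) dvd int (fib n) - int (fib r) \<or> int (lucas m) dvd int (fib n) + int (fib r))"
proof (induction n rule: less_induct)
  case (less n)
  consider "n \<le> m" | "m < n" "n < 2 * m" | "2 * m \<le> n" by linarith
  then show ?case
  proof cases
    case 1
    then show ?thesis by (intro exI[of _ n]) auto
  next
    case 2
    define j k where "j = n - m" and "k = 2 * m - n"
    have "n = 2 * j + k" "m = j + k" using 2 by (auto simp: j_def k_def)
    then have "int (fib n) = int (lucas m) * int (fib j) + (-1) ^ j * int (fib k)"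
      using fib_double_add[of j k] by simp
    then have "int (lucas m) dvd int (fib n) - int (fib k) \<or> int (lucas m) dvd int (fib n) + int (fib k)"
      by (cases "even j") auto
    moreover have "int (2 * m) dvd int n + int k" using 2 by (simp add: k_def of_nat_diff)
    ultimately show ?thesis using \<open>m = j + k\<close> by (intro exI[of _ k]) auto
  next
    case 3
    define l where "l = n - 2 * m"
    have n: "n = l + 2 * m" using 3 by (simp add: l_def)
    obtain r where r: "r \<le> m" "int (2 * m) dvd int l - int r \<or> int (2 * m) dvd int l + int r"
      "int (lucas m) dvd int (fib l) - int (fib r) \<or> int (lucas m) dvd int (fib l) + int (fib r)"
      using less.IH[of l] assms n by auto
    have "int (2 * m) dvd int n - int r \<or> int (2 * m) dvd int n + int r"
      using r(2)
    proof
      assume "int (2 * m) dvd int l - int r"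
      then have "int (2 * m) dvd (int l - int r) + int (2 * m)" by (rule dvd_add) simp
      then show ?thesis by (simp add: n algebra_simps)
    next
      assume "int (2 * m) dvd int l + int r"
      then have "int (2 * m) dvd (int l + int r) + int (2 * m)" by (rule dvd_add) simp
      then show ?thesis by (simp add: n algebra_simps)
    qed
    moreover have "int (fib n) = int (lucas m) * int (fib (l + m)) - (-1) ^ m * int (fib l)"
      unfolding n by (rule fib_add_double)
    then have "int (lucas m) dvd int (fib n) - int (fib l) \<or> int (lucas m) dvd int (fib n) + int (fib l)"
      by (cases "even m") auto
    then have "int (lucas m) dvd int (fib n) - int (fib r) \<or> int (lucas m) dvd int (fib n) + int (fib r)"
      using r(3) by (rule dvd_plus_minus_trans)
    ultimately show ?thesis using r(1) by blast
  qed
qed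

lemma fib_eq_less_imp:
  assumes "fib a = fib b" "a < b"
  shows "a = 1 \<and> b = 2"
proof -
  have "fib (Suc (Suc a)) < fib (Suc (Suc (Suc a)))" for a
    using fib_neq_0_nat[of "Suc a"] by (simp add: eval_nat_numeral)
  then have mono: "fib a < fib (Suc a)" if "2 \<le> a" for a
    using that by (auto dest!: le_Suc_ex simp: eval_nat_numeral)
  have "a < 2"
  proof (rule ccontr)
    assume "\<not> a < 2"
    then have "fib a < fib (Suc a)" by (intro mono) simp
    also have "\<dots> \<le> fib b" using assms(2) by (intro fib_mono) simp
    finally show False using assms(1) by simp
  qed
  moreover have "a \<noteq> 0"
  proof
    assume "a = 0"
    then show False using assms fib_neq_0_nat[of b] by simp
  qed
  ultimately have "a = 1" by simp
  moreover have "\<not> 2 < b"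
  proof
    assume "2 < b"
    then have "fib (Suc 2) \<le> fib b" by (intro fib_mono) simp
    moreover have "fib 2 < fib (Suc 2)" by (rule mono) simp
    ultimately show False using assms(1) \<open>a = 1\<close> by simp
  qed
  ultimately show ?thesis using assms(2) by simp
qed

lemma lucas_index_le_if_odd_index_diff:
  assumes eq: "fib n = 10 ^ d * lucas m + fib k"
    and n: "n = k + m + c" and odd: "odd (m + c)"
  shows "m \<le> c + 3"
proof (rule ccontr)
  assume "\<not> m \<le> c + 3"
  then have m: "c + 3 < m" by simp
  then have "0 < m" by simp
  obtain r where r: "r \<le> m" "int (2 * m) dvd int n - int r \<or> int (2 * m) dvd int n + int r"
      "int (lucas m) dvd int (fib n) - int (fib r) \<or> int (lucas m) dvd int (fib n) + int (fib r)"
    using fib_mod_lucas[OF \<open>0 < m\<close>] by blast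
  obtain s where s: "s \<le> m" "int (2 * m) dvd int k - int s \<or> int (2 * m) dvd int k + int s"
      "int (lucas m) dvd int (fib k) - int (fib s) \<or> int (lucas m) dvd int (fib k) + int (fib s)"
    using fib_mod_lucas[OF \<open>0 < m\<close>] by blast
  have "int (lucas m) dvd int (fib n) - int (fib k) \<or> int (lucas m) dvd int (fib n) + int (fib k)"
    by (simp add: eq)
  moreover have "int (lucas m) dvd int (fib r) - int (fib n) \<or> int (lucas m) dvd int (fib r) + int (fib n)"
    using r(3) by (simp add: dvd_diff_commute add.commute)
  ultimately have dvd: "int (lucas m) dvd int (fib r) - int (fib s) \<or> int (lucas m) dvd int (fib r) + int (fib s)"
    using s(3) dvd_plus_minus_trans by blast
  have "fib r \<le> fib m" "fib s \<le> fib m" using r(1) s(1) by (auto intro: fib_mono)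
  moreover have "2 * fib m < lucas m"
  \<comment> \<open>L_m - 2 F_m = F_(m-3), which is positive for m at least 4.\<close>
  proof -
    obtain q where q: "m = 4 + q" using m le_Suc_ex[of 4 m] by auto
    show ?thesis
      using lucas_int[of m] fib_neq_0_nat[of "Suc q"] by (simp add: q eval_nat_numeral)
  qed
  ultimately have small: "fib r + fib s < lucas m" by linarith
  have eq_fib: "fib r = fib s"
    using dvd
  proof
    assume "int (lucas m) dvd int (fib r) - int (fib s)"
    moreover have "\<bar>int (fib r) - int (fib s)\<bar> < int (lucas m)" using small by linarith
    ultimately show ?thesis using dvd_imp_le_int[of "int (fib r) - int (fib s)" "int (lucas m)"] by auto
  next
    assume "int (lucas m) dvd int (fib r) + int (fib s)"
    then have "lucas m dvd fib r + fib s" by (simp only: of_nat_add[symmetric] int_dvd_int_iff)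
    then have "fib r + fib s = 0" using small by (meson nat_dvd_not_less neq0_conv)
    then show ?thesis by simp
  qed
  have two: "even a" if "int (2 * m) dvd a" for a
    using that by (rule dvd_trans[rotated]) simp
  \<comment> \<open>The modulus 2m is even, so r and s inherit the parities of n and k.\<close>
  have "even (int n - int r)" "even (int k - int s)"
    using r(2) s(2) two by force+
  moreover have "odd (int n - int k)" using odd n by simp
  ultimately have "r \<noteq> s" by auto
  then have rs: "r = 1 \<and> s = 2 \<or> r = 2 \<and> s = 1"
    using fib_eq_less_imp[of r s] fib_eq_less_imp[of s r] eq_fib by linarith
  obtain a where a: "int (2 * m) dvd int n + a" "a = int r \<or> a = - int r" using r(2) by force
  obtain b where b: "int (2 * m) dvd int k + b" "b = int s \<or> b = - int s" using s(2) by force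
  \<comment> \<open>Subtracting leaves a multiple of 2m that m > c + 3 places strictly between 0 and
    2m.\<close>
  have "int (2 * m) dvd (int n + a) - (int k + b)" using a(1) b(1) by (rule dvd_diff)
  then have "int (2 * m) dvd int m + int c + (a - b)" by (simp add: n algebra_simps)
  moreover have "\<bar>a - b\<bar> \<le> 3" using a(2) b(2) rs by auto
  then have "0 < int m + int c + (a - b)" "int m + int c + (a - b) < int (2 * m)"
    using m by linarith+
  ultimately show False using zdvd_not_zless by blast
qed

section \<open>Residues modulo 16, 5 and 11, and finite checks\<close>

lemma eleven_dvd_ten_pow_pm_1: "int 11 dvd 10 ^ d - 1 \<or> int 11 dvd 10 ^ d + 1"
proof (induction d)
  case (Suc d)
  then show ?case by (simp; presburger)
qed simp

primrec fib_list :: "nat \<Rightarrow> int \<Rightarrow> int \<Rightarrow> int list" where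
  "fib_list 0 a b = []"
| "fib_list (Suc n) a b = a # fib_list n b (a + b)"

lemma fib_list_nth: "i < n \<Longrightarrow> fib_list n (int (fib j)) (int (fib (Suc j))) ! i = int (fib (j + i))"
proof (induction n arbitrary: i j)
  case (Suc n)
  show ?case
  proof (cases i)
    case (Suc i')
    then show ?thesis using Suc.IH[of i' "Suc j"] Suc.prems by (simp add: add.commute)
  qed simp
qed simp

text \<open>Length 50 suffices: the largest index looked up is k + m + c = 46, at k = 16, c = 7 and
  m = k + c.\<close>

definition fib_table :: "int list" where
  "fib_table = fib_list 50 0 1"

lemma fib_table_nth: "i < 50 \<Longrightarrow> fib_table ! i = int (fib i)"
  using fib_list_nth[of i 50 0] by (simp add: fib_table_def)

text \<open>In the following checks, \<open>2 * T ! Suc m - T ! m\<close> is the Lucas number with index \<open>m\<close>.\<close>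

definition check_mod16 :: "int list \<Rightarrow> bool" where
  "check_mod16 T = list_all (\<lambda>k. list_all (\<lambda>s. (T ! (k + s) - T ! k) mod 16 = 0 \<longrightarrow>
     s = 1 \<or> s = 3 \<and> odd k \<or> s = 11 \<or> s = 13) [1,3,5,7,9,11,13,15,17]) [0..<24]"

lemma check_mod16: "check_mod16 fib_table"
  by code_simp

definition check_mod55 :: "int list \<Rightarrow> bool" where
  "check_mod55 T = list_all (\<lambda>c. list_all (\<lambda>m.
     let s = m + c; L = 2 * T ! Suc m - T ! m in s = 1 \<or> s = 3 \<or> s = 11 \<or> s = 13 \<longrightarrow>
       list_all (\<lambda>k. let G = T ! (k + s) - T ! k in
         G mod 5 = 0 \<and> ((G - L) mod 11 = 0 \<or> (G + L) mod 11 = 0) \<longrightarrow> s = 3 \<and> even k) [0..<20])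
     [0..<c + 4]) [0..<8]"

lemma check_mod55: "check_mod55 fib_table"
  by code_simp

text \<open>\<open>t\<close> stands for 10^d with d at most 3; the ranges are those given by k < 5d
  + 2 and the bounds on c and m.\<close>

definition check_small :: "int list \<Rightarrow> bool" where
  "check_small T = list_all (\<lambda>k. list_all (\<lambda>t. if T ! k < t \<and> t \<le> 10 * T ! k then 
     list_all (\<lambda>c. list_all (\<lambda>m. let N = T ! (k + m + c) in
        N = t * (2 * T ! Suc m - T ! m) + T ! k \<longrightarrow> N = 13 \<or> N = 21) [0..<k + c + 1]) [0..<8]
     else True) [10, 100, 1000]) [1..<17]"

lemma check_small: "check_small fib_table"
  by code_simp

text \<open>The hypotheses say that (F_p, F_(p+1)) is (0, 1) modulo M, so the sequence has period p
  modulo M.\<close>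

lemma fib_period:
  fixes M :: int
  assumes "M dvd int (fib p)" "M dvd int (fib (Suc p)) - 1"
  shows "M dvd int (fib (p * q + k)) - int (fib k)"
proof (induction q)
  case (Suc q)
  let ?l = "p * q + k"
  have "int (fib (?l + p)) - int (fib ?l) = int (fib ?l) * (int (fib (Suc p)) - 1)
      + (int (fib (Suc ?l)) - int (fib ?l)) * int (fib p)"
    unfolding fib_add_int[of ?l p] by (simp add: algebra_simps)
  then have "M dvd int (fib (?l + p)) - int (fib ?l)"
    using assms by (metis dvd_add dvd_mult)
  from dvd_add[OF this Suc.IH] show ?case by (simp add: ac_simps)
qed simp

lemma fib_diff_period:
  fixes M :: int
  assumes "M dvd int (fib p)" "M dvd int (fib (Suc p)) - 1"
  shows "M dvd (int (fib (k + s)) - int (fib k))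
     - (int (fib (k mod p + s)) - int (fib (k mod p)))"
proof -
  have "M dvd int (fib (p * (k div p) + (k mod p + s))) - int (fib (k mod p + s))"
    using assms by (rule fib_period)
  moreover have "M dvd int (fib (p * (k div p) + k mod p)) - int (fib (k mod p))"
    using assms by (rule fib_period)
  ultimately have "M dvd (int (fib (p * (k div p) + (k mod p + s))) - int (fib (k mod p + s)))
     - (int (fib (p * (k div p) + k mod p)) - int (fib (k mod p)))"
    by (rule dvd_diff)
  then show ?thesis by (simp add: add.assoc[symmetric] algebra_simps)
qed

text \<open>The Fibonacci sequence has period 24 modulo 16. The bound 17 is the largest m + c with c
  at most 7 and m at most c + 3.\<close>

lemma fib_diff_mod16:
  assumes "16 dvd int (fib (k + s)) - int (fib k)" "odd s" "s \<le> 17"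
  shows "s \<in> {1, 3, 11, 13} \<and> (s = 3 \<longrightarrow> odd k)"
proof -
  have "fib_table ! 24 mod 16 = 0 \<and> fib_table ! 25 mod 16 = 1" by code_simp
  then have p: "16 dvd int (fib 24)" "16 dvd int (fib (Suc 24)) - 1"
    by (simp_all add: fib_table_nth) presburger+
  define k' where "k' = k mod 24"
  have k': "k' < 24" "odd k' \<longleftrightarrow> odd k" unfolding k'_def by (simp, presburger)
  from dvd_diff[OF assms(1) fib_diff_period[OF p, of k s]]
  have "16 dvd int (fib (k' + s)) - int (fib k')" by (simp add: k'_def)
  then have zero: "(fib_table ! (k' + s) - fib_table ! k') mod 16 = 0"
    using k'(1) assms(3) by (simp add: fib_table_nth)
  have s_mem: "s \<in> set [1,3,5,7,9,11,13,15,17]"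
    using assms(2,3) by (auto elim!: oddE)
  have k_mem: "k' \<in> set [0..<24]" using k' by simp
  have "s = 1 \<or> s = 3 \<and> odd k' \<or> s = 11 \<or> s = 13"
    using check_mod16[unfolded check_mod16_def list_all_iff, THEN bspec, OF k_mem, THEN bspec, OF s_mem]
      zero by (rule mp)
  then show ?thesis using k'(2) by auto
qed

text \<open>Modulo 16 the case s = 3 needs odd k; modulo 5 and 11 only s = 3 with even k survives.
  The joint period modulo 55 is 20.\<close>

lemma no_odd_index_diff_large:
  assumes eq: "fib n = 10 ^ d * lucas m + fib k"
    and n: "n = k + m + c" and odd: "odd (m + c)"
    and c: "c \<le> 7" "m \<le> c + 3" and d: "4 \<le> d"
  shows False
proof -
  define s L where "s = m + c" and "L = int (lucas m)"
  define G where "G k = int (fib (k + s)) - int (fib k)" for k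
  have G: "G k = 10 ^ d * L"
    using eq by (simp add: G_def n s_def L_def add.assoc)
  have "(10::int) ^ 4 dvd 10 ^ d" using d by (rule le_imp_power_dvd)
  then have "(16::int) dvd 10 ^ d" "(5::int) dvd 10 ^ d"
    by (auto elim!: dvd_trans[rotated])
  then have "16 dvd G k" "5 dvd G k" unfolding G by simp_all
  then have s: "s \<in> {1, 3, 11, 13} \<and> (s = 3 \<longrightarrow> odd k)"
    using odd c by (intro fib_diff_mod16) (auto simp: G_def s_def)
  have 11: "11 dvd G k - L \<or> 11 dvd G k + L"
  proof -
    have "G k - L = (10 ^ d - 1) * L" "G k + L = (10 ^ d + 1) * L"
      unfolding G by (simp_all add: algebra_simps)
    then show ?thesis using eleven_dvd_ten_pow_pm_1[of d] by auto
  qed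
  have "fib_table ! 20 mod 55 = 0 \<and> fib_table ! 21 mod 55 = 1" by code_simp
  then have p: "55 dvd int (fib 20)" "55 dvd int (fib (Suc 20)) - 1"
    by (simp_all add: fib_table_nth) presburger+
  define k' where "k' = k mod 20"
  have k': "k' < 20" "odd k' \<longleftrightarrow> odd k" unfolding k'_def by (simp, presburger)
  have "55 dvd G k - G k'"
    using fib_diff_period[OF p, of k s] by (simp add: G_def k'_def)
  with \<open>5 dvd G k\<close> 11 have G': "G k' mod 5 = 0" "(G k' - L) mod 11 = 0 \<or> (G k' + L) mod 11 = 0"
    by presburger+
  have "fib_table ! (k' + s) - fib_table ! k' = G k'" "2 * fib_table ! Suc m - fib_table ! m = L"
    using k'(1) c lucas_int[of m] by (simp_all add: fib_table_nth G_def L_def s_def)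
  moreover have mem: "c \<in> set [0..<8]" "m \<in> set [0..<c + 4]" "k' \<in> set [0..<20]"
    using c k' by simp_all
  ultimately have "s = 3 \<and> even k'"
    using check_mod55[unfolded check_mod55_def list_all_iff Let_def, THEN bspec, OF mem(1),
        THEN bspec, OF mem(2), folded s_def, THEN mp, THEN bspec, OF _ mem(3)] s G'
    by simp
  then show False using s k'(2) by simp
qed

section \<open>The case \<open>k = 0\<close> and the conclusion\<close>

lemma pow5_gt: "2 \<le> d \<Longrightarrow> 15 * d + 17 < 2 * 5 ^ d"
  by (induction d rule: nat_induct_at_least) simp_all

lemma ten_mult_lucas_not_fib: "fib n \<noteq> 10 * lucas m"
proof
  assume eq: "fib n = 10 * lucas m"
  have between: False if "fib j < fib n" "fib n < fib (Suc j)" for j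
    using fib_less_imp_less[OF that(1)] fib_less_imp_less[OF that(2)] by simp
  consider "m = 0" | "m = 1" | q where "m = Suc (Suc q)"
    by (metis One_nat_def not0_implies_Suc)
  then show False
  proof cases
    case 1
    then show False using eq between[of 7] by (simp add: eval_nat_numeral)
  next
    case 2
    then show False using eq fib_not_pow10[of 1 n] by simp
  next
    case 3
    have pos: "0 < fib (Suc q)" by (rule fib_neq_0_nat) simp
    have L: "lucas (Suc (Suc q)) = 3 * fib (Suc q) + fib q"
      using lucas_int[of "Suc (Suc q)"] by (simp del: lucas.simps)
    have "fib n = 30 * fib (Suc q) + 10 * fib q"
      unfolding eq 3 L by simp
    \<comment> \<open>10 L_m lies strictly between F_(m+6) and F_(m+7), where m = q + 2.\<close>
    then show False using pos fib_Suc_mono[of q]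
      by (intro between[of "q + 8"]) (simp_all add: eval_nat_numeral)
  qed
qed

lemma fib_concatenation_cases:
  assumes "fib n = concatenation (lucas m) (fib k)"
  shows "fib n = 13 \<or> fib n = 21"
proof (cases "k = 0")
  case True
  then have "fib n = 10 * lucas m"
    using assms by (simp add: concatenation_def num_digits_def)
  then show ?thesis using ten_mult_lucas_not_fib by simp
next
  case False
  then have k: "0 < k" by simp
  then have "0 < fib k" by (rule fib_neq_0_nat)
  define d where "d = num_digits (fib k)"
  have lo: "10 ^ d \<le> 10 * fib k" and hi: "fib k < 10 ^ d"
    using num_digits_fib[OF \<open>0 < fib k\<close>] by (simp_all add: d_def)
  have d: "0 < d" by (simp add: d_def num_digits_def)
  have eq: "fib n = 10 ^ d * lucas m + fib k"
    using assms by (simp add: concatenation_def d_def)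
  obtain c where n: "n = k + m + c" and c: "c \<le> 7"
    using concatenation_index_bounds[OF eq k lo hi] .
  have m: "m \<le> k + c" using lucas_index_bound[OF eq k d n] .
  have "fib k < fib (5 * d + 2)" using hi pow10_le_fib[of d] by simp
  then have kd: "k < 5 * d + 2" by (rule fib_less_imp_less)
  have "d < 4"
  proof (rule ccontr)
    assume "\<not> d < 4"
    show False
    proof (cases "even (m + c)")
      case True
      then obtain v where v: "m + c = 2 * v" by blast
      have "fib k < fib n" using eq lucas_pos[of m] by simp
      then have "0 < v" using fib_less_imp_less n v by fastforce
      then have "5 ^ d \<le> k + v" using pow5_le_if_even_index_diff[OF eq, of v] n v by simp
      \<comment> \<open>2(k + v) = 2k + m + c is at most 3k + 2c, where k is at most 5d + 1 and c at
        most 7.\<close>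
      then have "2 * 5 ^ d \<le> 15 * d + 17" using v m c kd by linarith
      then show False using pow5_gt[of d] \<open>\<not> d < 4\<close> by simp
    next
      case False
      then show False
        using no_odd_index_diff_large[OF eq n] lucas_index_le_if_odd_index_diff[OF eq n] c \<open>\<not> d < 4\<close> by simp
    qed
  qed
  define t where "t = (10::int) ^ d"
  have "d = 1 \<or> d = 2 \<or> d = 3" using d \<open>d < 4\<close> by linarith
  then have "t \<in> set [10, 100, 1000]" by (auto simp: t_def)
  moreover have "k \<in> set [1..<17]" "c \<in> set [0..<8]" "m \<in> set [0..<k + c + 1]"
    using k kd \<open>d < 4\<close> c m by auto
  moreover have "k < 17" using kd \<open>d < 4\<close> by simp
  then have T: "fib_table ! k = int (fib k)" "fib_table ! (k + m + c) = int (fib n)"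
    "2 * fib_table ! Suc m - fib_table ! m = int (lucas m)"
    using c m lucas_int[of m] by (simp_all add: fib_table_nth n)
  moreover have "int (fib k) < int (10 ^ d)" "int (10 ^ d) \<le> int (10 * fib k)"
    using lo hi by (simp_all only: of_nat_less_iff of_nat_le_iff)
  then have "int (fib k) < t" "t \<le> 10 * int (fib k)" by (simp_all add: t_def)
  moreover have "int (fib n) = t * int (lucas m) + int (fib k)" by (simp add: eq t_def)
  ultimately have "int (fib n) = 13 \<or> int (fib n) = 21"
    using check_small unfolding check_small_def list_all_iff Let_def by (smt (verit))
  then show ?thesis by linarith
qed

lemma num_digits_one:
  assumes "0 < b" "b < 10"
  shows "num_digits b = 1"
proof -
  have "(10::nat) ^ num_digits b < 10 ^ 2" using num_digits_fib(1)[of b] assms by simp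
  then have "num_digits b < 2" by (rule power_less_imp_less_exp[rotated]) simp
  moreover have "0 < num_digits b" by (simp add: num_digits_def)
  ultimately show ?thesis by linarith
qed

theorem theorem2:
  shows "{fib n | n. \<exists>m k. fib n = concatenation (lucas m) (fib k)} = {13, 21}"
proof -
  \<comment> \<open>13 joins L_1 = 1 and F_4 = 3; 21 joins L_0 = 2 and F_1 = 1.\<close>
  have "fib 7 = concatenation (lucas 1) (fib 4)" "fib 8 = concatenation (lucas 0) (fib 1)"
    by (simp_all add: concatenation_def num_digits_one eval_nat_numeral)
  moreover have "fib 7 = 13" "fib 8 = 21" by (simp_all add: eval_nat_numeral)
  ultimately show ?thesis using fib_concatenation_cases by (auto; metis)
qed

end
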